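(* Let $n\in\mathbb{N}^+$. There is a compact metric space $K$ such that $\dim_T K=\infty$, and for each $f\in C(K,\mathbb{R}^n)$ there is a $y_f\in\mathbb{R}^n$ such that $\dim_T f^{-1}(y)<\infty$ for all $y\in\mathbb{R}^n\setminus\{y_f\}$.
   Context: $\dim_T$ is the topological dimension (small inductive dimension: $\dim_T\emptyset=-1$ and $\dim_T X=\inf\{d: X$ has a basis $\mathcal{U}$ with $\dim_T\partial U\leq d-1$ for all $U\in\mathcal{U}\}$). $C(K,\mathbb{R}^n)$ is the set of continuous maps $K\to\mathbb{R}^n$. *)

theory Defs
  imports "HOL-Analysis.Analysis"
begin

text \<open>
  Small inductive dimension, with value \<^term>\<open>\<infinity> :: ereal\<close> when no bound exists.
  The library relation \<^const>\<open>dimension_le\<close> is the recursion on bounds;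
  \<open>dim_T_empty\<close> and \<open>dim_T_nonempty\<close> below recover the usual recursive definition
  through bases.
\<close>

definition dim_T :: "'a topology \<Rightarrow> ereal" where
  "dim_T X = Inf {ereal (real_of_int d) | d. X dim_le d}"

lemma dim_T_le_iff: "dim_T X \<le> ereal (real_of_int n) \<longleftrightarrow> X dim_le n"
proof
  assume "X dim_le n"
  then show "dim_T X \<le> ereal (real_of_int n)"
    unfolding dim_T_def by (intro Inf_lower) blast
next
  assume *: "dim_T X \<le> ereal (real_of_int n)"
  then have "Inf {ereal (real_of_int d) | d. X dim_le d} < ereal (real_of_int (n + 1))"
    unfolding dim_T_def by (rule le_less_trans) simp
  then obtain d where "X dim_le d" "d < n + 1"
    unfolding Inf_less_iff by auto
  then show "X dim_le n"
    using dimension_le_mono by fastforce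
qed

lemma dim_T_empty:
  assumes "topspace X = {}"
  shows "dim_T X = -1"
proof (rule antisym)
  have "X dim_le -1"
    using assms by simp
  then show "dim_T X \<le> -1"
    using dim_T_le_iff[of X "-1"] by (simp add: one_ereal_def)
  show "-1 \<le> dim_T X"
    unfolding dim_T_def
    by (rule Inf_greatest) (use dimension_le_bound in \<open>force simp: one_ereal_def\<close>)
qed

lemma dim_T_nonempty:
  assumes "topspace X \<noteq> {}"
  shows "dim_T X = Inf {ereal (real d) | d. \<exists>\<B>. openin X = arbitrary union_of (\<lambda>U. U \<in> \<B>) \<and>
           (\<forall>U\<in>\<B>. dim_T (subtopology X (X frontier_of U)) \<le> ereal (real d) - 1)}"
proof -
  have base: "X dim_le int d \<longleftrightarrow>
      (\<exists>\<B>. openin X = arbitrary union_of (\<lambda>U. U \<in> \<B>) \<and>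
           (\<forall>U\<in>\<B>. dim_T (subtopology X (X frontier_of U)) \<le> ereal (real d) - 1))"
    (is "_ \<longleftrightarrow> ?R") for d
  proof -
    have eq: "ereal (real d) - 1 = ereal (real_of_int (int d - 1))"
      by (simp add: one_ereal_def)
    have "?R \<longleftrightarrow> (\<exists>\<B>. openin X = arbitrary union_of (\<lambda>U. U \<in> \<B>) \<and>
           (\<forall>U\<in>\<B>. subtopology X (X frontier_of U) dim_le (int d - 1)))"
      unfolding eq dim_T_le_iff ..
    also have "\<dots> \<longleftrightarrow> neighbourhood_base_of
        (\<lambda>U. openin X U \<and> subtopology X (X frontier_of U) dim_le (int d - 1)) X"
      (is "?B \<longleftrightarrow> ?N")
    proof
      assume ?B
      then obtain \<B> where "openin X = arbitrary union_of (\<lambda>U. U \<in> \<B>)"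
        and \<B>: "\<And>U. U \<in> \<B> \<Longrightarrow> subtopology X (X frontier_of U) dim_le (int d - 1)" by blast
      then have "\<And>U. U \<in> \<B> \<Longrightarrow> openin X U" "neighbourhood_base_of (\<lambda>U. U \<in> \<B>) X"
        by (simp_all add: openin_topology_neighbourhood_base_unique)
      then show ?N
        using \<B> by (auto elim: neighbourhood_base_of_mono)
    next
      assume ?N
      then show ?B
        by (intro exI[of _ "{U. openin X U \<and> subtopology X (X frontier_of U) dim_le (int d - 1)}"])
          (simp add: openin_topology_neighbourhood_base_unique)
    qed
    also have "\<dots> \<longleftrightarrow> X dim_le int d"
      using dimension_le_neighbourhood_base[of X "int d"] by auto
    finally show ?thesis by (rule sym)
  qed
  have nonneg: "d \<ge> 0" if "X dim_le d" for d
  proof (rule ccontr)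
    assume "\<not> 0 \<le> d"
    then have "X dim_le -1"
      using that dimension_le_mono[of X d "-1"] by simp
    with assms show False by simp
  qed
  have "{ereal (real_of_int d) | d. X dim_le d} = {ereal (real d) | d. X dim_le int d}"
    (is "?A = ?B")
  proof
    show "?A \<subseteq> ?B"
    proof
      fix x assume "x \<in> ?A"
      then obtain d where d: "x = ereal (real_of_int d)" "X dim_le d" by blast
      then obtain k where "d = int k" using nonneg nonneg_int_cases by blast
      with d show "x \<in> ?B" by auto
    qed
    show "?B \<subseteq> ?A"
    proof
      fix x assume "x \<in> ?B"
      then obtain d where "x = ereal (real_of_int (int d))" "X dim_le int d" by auto
      then show "x \<in> ?A" by blast
    qed
  qed
  then show ?thesis
    unfolding base[symmetric] by (simp only: dim_T_def)
qed

end

theory Submission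
  imports Defs
begin

text \<open>
  The space consists of the points \<open>x\<close> of the Hilbert cube with \<open>x\<^sub>i \<le> x\<^sub>0\<close>, and \<open>x\<^sub>i = 0\<close> as soon as
  \<open>i x\<^sub>0 > 1\<close>. Its only point with \<open>x\<^sub>0 = 0\<close> is the origin, so a fibre of \<open>f\<close> over \<open>y \<noteq> f 0\<close> is compact
  with \<open>x\<^sub>0\<close> bounded below, and only finitely many coordinates vary on it. Such a set has finite
  dimension. The slice \<open>x\<^sub>0 = 1/m\<close>, however, is an \<open>m\<close>-dimensional cube. To see that its dimension is
  at least \<open>m\<close>, one shows that in a compact Hausdorff space of dimension less than \<open>m\<close> any \<open>m\<close> pairs of
  disjoint closed sets enlarge to \<open>m\<close> pairs of disjoint closed sets which cover the space; for the pairs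
  of opposite faces of the cube this contradicts Kuhn's cubical form of Sperner's lemma.
\<close>

section \<open>Pairs of disjoint closed sets and their enlargements\<close>

definition separated_pairs :: "'a topology \<Rightarrow> nat \<Rightarrow> (nat \<Rightarrow> 'a set) \<Rightarrow> (nat \<Rightarrow> 'a set) \<Rightarrow> bool" where
  "separated_pairs X d A B \<longleftrightarrow> (\<forall>i<d. closedin X (A i) \<and> closedin X (B i) \<and> A i \<inter> B i = {})"

lemma separated_pairsD:
  assumes "separated_pairs X d A B" "i < d"
  shows "closedin X (A i)" "closedin X (B i)" "A i \<inter> B i = {}"
  using assms by (simp_all add: separated_pairs_def)

text \<open>For \<open>Y = topspace X\<close> this is a form of the Eilenberg-Otto criterion for
  dimension below \<open>d\<close>: the sets left over between \<open>P i\<close> and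
  \<open>Q i\<close> have no common point. The pairs live on all of \<open>X\<close> while only
  \<open>Y\<close> has to be covered, so that coverings of several sets can be built up inside one
  space.\<close>

definition partitionable :: "'a topology \<Rightarrow> 'a set \<Rightarrow> nat \<Rightarrow> bool" where
  "partitionable X Y d \<longleftrightarrow>
    (\<forall>A B. separated_pairs X d A B \<longrightarrow>
      (\<exists>P Q. separated_pairs X d P Q \<and> (\<forall>i<d. A i \<subseteq> P i \<and> B i \<subseteq> Q i) \<and> Y \<subseteq> (\<Union>i<d. P i \<union> Q i)))"

lemma partitionableD:
  assumes "partitionable X Y d" "separated_pairs X d A B"
  obtains P Q where "separated_pairs X d P Q" "\<forall>i<d. A i \<subseteq> P i \<and> B i \<subseteq> Q i" "Y \<subseteq> (\<Union>i<d. P i \<union> Q i)"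
proof -
  note assms(1)[unfolded partitionable_def, THEN spec[where x = A], THEN spec[where x = B], THEN mp, OF assms(2)]
  then obtain P Q where "separated_pairs X d P Q \<and> (\<forall>i<d. A i \<subseteq> P i \<and> B i \<subseteq> Q i) \<and> Y \<subseteq> (\<Union>i<d. P i \<union> Q i)"
    by (elim exE)
  then show thesis
    by (intro that[of P Q]) simp_all
qed

lemma partitionableI:
  assumes "\<And>A B. separated_pairs X d A B \<Longrightarrow>
     \<exists>P Q. separated_pairs X d P Q \<and> (\<forall>i<d. A i \<subseteq> P i \<and> B i \<subseteq> Q i) \<and> Y \<subseteq> (\<Union>i<d. P i \<union> Q i)"
  shows "partitionable X Y d"
  using assms unfolding partitionable_def by simp

lemma partitionable_subset:
  assumes "partitionable X Y d" "Z \<subseteq> Y"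
  shows "partitionable X Z d"
proof (rule partitionableI)
  fix A B
  assume "separated_pairs X d A B"
  then obtain P Q where "separated_pairs X d P Q" "\<forall>i<d. A i \<subseteq> P i \<and> B i \<subseteq> Q i"
    "Y \<subseteq> (\<Union>i<d. P i \<union> Q i)"
    by (rule partitionableD[OF assms(1)])
  with assms(2) show "\<exists>P Q. separated_pairs X d P Q \<and> (\<forall>i<d. A i \<subseteq> P i \<and> B i \<subseteq> Q i) \<and>
      Z \<subseteq> (\<Union>i<d. P i \<union> Q i)"
    by (intro exI[of _ P] exI[of _ Q]) simp
qed

lemma partitionable_empty: "partitionable X {} d"
proof (rule partitionableI)
  fix A B
  assume "separated_pairs X d A B"
  then show "\<exists>P Q. separated_pairs X d P Q \<and> (\<forall>i<d. A i \<subseteq> P i \<and> B i \<subseteq> Q i) \<and>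
      {} \<subseteq> (\<Union>i<d. P i \<union> Q i)"
    by (intro exI[of _ A] exI[of _ B]) simp
qed

text \<open>The pairs obtained for \<open>Y\<close> are the input for \<open>Z\<close>: enlarging
  them a second time keeps \<open>Y\<close> covered.\<close>

lemma partitionable_Un:
  assumes "partitionable X Y d" "partitionable X Z d"
  shows "partitionable X (Y \<union> Z) d"
proof (rule partitionableI)
  fix A B
  assume "separated_pairs X d A B"
  then obtain P Q where PQ: "separated_pairs X d P Q"
    "\<forall>i<d. A i \<subseteq> P i \<and> B i \<subseteq> Q i" "Y \<subseteq> (\<Union>i<d. P i \<union> Q i)"
    by (rule partitionableD[OF assms(1)])
  obtain P' Q' where PQ': "separated_pairs X d P' Q'"
    "\<forall>i<d. P i \<subseteq> P' i \<and> Q i \<subseteq> Q' i" "Z \<subseteq> (\<Union>i<d. P' i \<union> Q' i)"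
    by (rule partitionableD[OF assms(2) PQ(1)])
  have "(\<Union>i<d. P i \<union> Q i) \<subseteq> (\<Union>i<d. P' i \<union> Q' i)"
    using PQ'(2) by (intro UN_mono Un_mono) auto
  then have "Y \<union> Z \<subseteq> (\<Union>i<d. P' i \<union> Q' i)"
    using PQ(3) PQ'(3) by simp
  moreover have "\<forall>i<d. A i \<subseteq> P' i \<and> B i \<subseteq> Q' i"
    using PQ(2) PQ'(2) by (meson order_trans)
  ultimately show "\<exists>P Q. separated_pairs X d P Q \<and> (\<forall>i<d. A i \<subseteq> P i \<and> B i \<subseteq> Q i) \<and>
      Y \<union> Z \<subseteq> (\<Union>i<d. P i \<union> Q i)"
    using PQ'(1) by (intro exI[of _ P'] exI[of _ Q']) simp
qed

lemma partitionable_Union: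
  assumes "finite \<F>" "\<And>S. S \<in> \<F> \<Longrightarrow> partitionable X S d"
  shows "partitionable X (\<Union>\<F>) d"
  using assms by (induction) (auto intro: partitionable_empty partitionable_Un)

text \<open>A solution on the traces of the pairs becomes one in \<open>X\<close> when the original
  sets are added back. No overlap arises: a point of \<open>A i\<close> in \<open>Q i\<close> lies
  in \<open>Y\<close>, hence in \<open>P i\<close>, which is disjoint from \<open>Q i\<close>.
  Closedness of \<open>Y\<close> makes \<open>P i\<close> and \<open>Q i\<close> closed in
  \<open>X\<close>.\<close>

lemma partitionable_subtopology:
  assumes "closedin X Y" "partitionable (subtopology X Y) Y d"
  shows "partitionable X Y d"
proof (rule partitionableI)
  fix A B
  assume AB: "separated_pairs X d A B"
  have "separated_pairs (subtopology X Y) d (\<lambda>i. Y \<inter> A i) (\<lambda>i. Y \<inter> B i)"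
    unfolding separated_pairs_def
    using separated_pairsD[OF AB] closedin_subtopology_Int_closed by blast
  then obtain P Q where PQ: "separated_pairs (subtopology X Y) d P Q"
    "\<forall>i<d. Y \<inter> A i \<subseteq> P i \<and> Y \<inter> B i \<subseteq> Q i" "Y \<subseteq> (\<Union>i<d. P i \<union> Q i)"
    by (rule partitionableD[OF assms(2)])
  have sub: "P i \<subseteq> Y" "Q i \<subseteq> Y" and cl: "closedin X (P i)" "closedin X (Q i)" if "i < d" for i
    using separated_pairsD(1,2)[OF PQ(1) that] assms(1) by (auto simp: closedin_closed_subtopology)
  have "(A i \<union> P i) \<inter> (B i \<union> Q i) = {}" if "i < d" for i
    using sub[OF that] PQ(2)[rule_format, OF that] separated_pairsD(3)[OF AB that] separated_pairsD(3)[OF PQ(1) that]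
    by blast
  then have "separated_pairs X d (\<lambda>i. A i \<union> P i) (\<lambda>i. B i \<union> Q i)"
    unfolding separated_pairs_def using separated_pairsD(1,2)[OF AB] cl by (simp add: closedin_Un)
  moreover have "Y \<subseteq> (\<Union>i<d. A i \<union> P i \<union> (B i \<union> Q i))"
    using PQ(3) by blast
  ultimately show "\<exists>P Q. separated_pairs X d P Q \<and> (\<forall>i<d. A i \<subseteq> P i \<and> B i \<subseteq> Q i) \<and>
      Y \<subseteq> (\<Union>i<d. P i \<union> Q i)"
    by (intro exI[of _ "\<lambda>i. A i \<union> P i"] exI[of _ "\<lambda>i. B i \<union> Q i"]) simp
qed

section \<open>Small inductive dimension bounds the number of essential pairs\<close>

lemma normal_space_disjoint_closures:
  assumes "normal_space X" "closedin X S" "closedin X T" "S \<inter> T = {}"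
  obtains U V where "openin X U" "openin X V" "S \<subseteq> U" "T \<subseteq> V"
    "X closure_of U \<inter> X closure_of V = {}"
proof -
  have "S \<subseteq> topspace X - T" "openin X (topspace X - T)"
    using assms closedin_subset by blast+
  then obtain U where U: "openin X U" "S \<subseteq> U" "X closure_of U \<subseteq> topspace X - T"
    using assms unfolding normal_space_alt by meson
  moreover have "T \<subseteq> topspace X - X closure_of U"
    using U(3) closedin_subset[OF assms(3)] by blast
  ultimately obtain V where "openin X V" "T \<subseteq> V" "X closure_of V \<subseteq> topspace X - X closure_of U"
    using assms unfolding normal_space_alt by (meson closedin_closure_of openin_diff openin_topspace)
  with U that show thesis by blast
qed

text \<open>The last pair is separated by the frontier of an open set, and the other
  \<open>d\<close> pairs are enlarged so that they cover a neighbourhood of that frontier. Away from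
  this neighbourhood the two sides of the frontier are disjoint closed sets, which serve the last
  pair.\<close>

lemma partitionable_Suc:
  assumes comp: "compact_space X" and norm: "normal_space X"
    and base: "\<And>V a. \<lbrakk>openin X V; a \<in> V\<rbrakk> \<Longrightarrow>
      \<exists>U. a \<in> U \<and> U \<subseteq> V \<and> openin X U \<and> partitionable X (X frontier_of U) d"
  shows "partitionable X (topspace X) (Suc d)"
proof (rule partitionableI)
  fix A B
  assume sep: "separated_pairs X (Suc d) A B"
  note cA = separated_pairsD(1)[OF sep] and cB = separated_pairsD(2)[OF sep] and AB = separated_pairsD(3)[OF sep]
  obtain V V' where V: "openin X V" "openin X V'" "A d \<subseteq> V" "B d \<subseteq> V'"
    "X closure_of V \<inter> X closure_of V' = {}"
    using normal_space_disjoint_closures[OF norm cA cB AB] by blast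
  \<comment> \<open>Compactness of \<open>A d\<close> reduces the good neighbourhoods to finitely
    many, and the frontier of a finite union lies in the union of the frontiers. Staying inside
    \<open>V\<close> keeps the closure away from \<open>B d\<close>.\<close>
  define \<U> where "\<U> = {U. U \<subseteq> V \<and> openin X U \<and> partitionable X (X frontier_of U) d}"
  have \<U>: "U \<subseteq> V" "openin X U" "partitionable X (X frontier_of U) d" if "U \<in> \<U>" for U
    using that by (auto simp: \<U>_def)
  have "compactin X (A d)"
    using cA comp closedin_compact_space by blast
  moreover have "A d \<subseteq> \<Union>\<U>"
    using base[OF V(1)] V(3) unfolding \<U>_def by blast
  moreover have "\<forall>U\<in>\<U>. openin X U" using \<U>(2) by blast
  ultimately have "\<exists>\<F>. finite \<F> \<and> \<F> \<subseteq> \<U> \<and> A d \<subseteq> \<Union>\<F>"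
    unfolding compactin_def by meson
  then obtain \<F> where \<F>: "finite \<F>" "\<F> \<subseteq> \<U>" "A d \<subseteq> \<Union>\<F>"
    by blast
  define U where "U = \<Union>\<F>"
  have U: "openin X U" "A d \<subseteq> U" "U \<subseteq> V"
    using \<F> \<U> unfolding U_def by blast+
  have frU: "partitionable X (X frontier_of U) d"
  proof (rule partitionable_subset)
    show "partitionable X (\<Union>((\<lambda>T. X frontier_of T) ` \<F>)) d"
      using \<F>(1,2) \<U>(3) by (intro partitionable_Union) auto
    show "X frontier_of U \<subseteq> \<Union>((\<lambda>T. X frontier_of T) ` \<F>)"
      unfolding U_def by (rule frontier_of_Union_subset[OF \<F>(1)])
  qed
  have clU: "X closure_of U \<inter> B d = {}"
    using closure_of_mono[OF U(3)] V(4,5) closure_of_subset[OF openin_subset[OF V(2)]] by blast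
  have "separated_pairs X d A B"
    using sep by (simp add: separated_pairs_def)
  then obtain P Q where PQ: "separated_pairs X d P Q"
    "\<forall>i<d. A i \<subseteq> P i \<and> B i \<subseteq> Q i" "X frontier_of U \<subseteq> (\<Union>i<d. P i \<union> Q i)"
    by (rule partitionableD[OF frU])
  \<comment> \<open>Thickening the closed pairs to open sets turns the cover of the frontier into a
    cover of its open neighbourhood \<open>N\<close>, so that removing \<open>N\<close> leaves
    closed sets closed.\<close>
  have "\<forall>i<d. \<exists>G H. openin X G \<and> openin X H \<and> P i \<subseteq> G \<and> Q i \<subseteq> H \<and>
      X closure_of G \<inter> X closure_of H = {}"
    using separated_pairsD[OF PQ(1)] normal_space_disjoint_closures[OF norm] by metis
  then obtain G H where GH: "\<And>i. i < d \<Longrightarrow> openin X (G i)" "\<And>i. i < d \<Longrightarrow> openin X (H i)"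
    "\<And>i. i < d \<Longrightarrow> P i \<subseteq> G i" "\<And>i. i < d \<Longrightarrow> Q i \<subseteq> H i"
    "\<And>i. i < d \<Longrightarrow> X closure_of (G i) \<inter> X closure_of (H i) = {}"
    by metis
  define N where "N = (\<Union>i<d. G i \<union> H i)"
  have "openin X N"
    unfolding N_def using GH by (intro openin_Union) auto
  have frN: "X frontier_of U \<subseteq> N"
  proof (rule order_trans[OF PQ(3)])
    show "(\<Union>i<d. P i \<union> Q i) \<subseteq> N"
      unfolding N_def using GH(3,4) by (intro UN_mono Un_mono) auto
  qed
  have GHc: "G i \<subseteq> X closure_of (G i)" "H i \<subseteq> X closure_of (H i)" if "i < d" for i
    using GH(1,2)[OF that] by (meson closure_of_subset openin_subset)+
  define P' where "P' i = (if i < d then X closure_of (G i) else A d \<union> (X closure_of U - N))" for i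
  define Q' where "Q' i = (if i < d then X closure_of (H i) else B d \<union> (topspace X - U - N))" for i
  have P'd: "P' d = A d \<union> (X closure_of U - N)" and Q'd: "Q' d = B d \<union> (topspace X - U - N)"
    by (auto simp: P'_def Q'_def)
  have pairs: "closedin X (P' i) \<and> closedin X (Q' i) \<and> A i \<subseteq> P' i \<and> B i \<subseteq> Q' i \<and> P' i \<inter> Q' i = {}"
    if "i < Suc d" for i
  proof -
    consider "i < d" | "i = d" using \<open>i < Suc d\<close> by linarith
    then show ?thesis
    proof cases
      case 1
      then show ?thesis
        using PQ(2)[rule_format, OF 1] GH(3-5)[of i] GHc[of i] by (auto simp: P'_def Q'_def)
    next
      case 2
      have "closedin X (P' d)" "closedin X (Q' d)"
        using cA cB \<open>openin X N\<close> U(1) unfolding P'd Q'd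
        by (auto intro!: closedin_Un closedin_diff)
      \<comment> \<open>A common point would lie in the closure of \<open>U\<close> but not in
        \<open>U\<close>, hence on the frontier, which \<open>N\<close> contains.\<close>
      moreover have "(X closure_of U - N) \<inter> (topspace X - U - N) = {}"
        using frN U(1) by (auto simp: frontier_of_def interior_of_openin)
      then have "P' d \<inter> Q' d = {}"
        using AB[of d] clU U(2) unfolding P'd Q'd by blast
      ultimately show ?thesis
        using 2 P'd Q'd by auto
    qed
  qed
  have cover: "topspace X \<subseteq> (\<Union>i<Suc d. P' i \<union> Q' i)"
  proof
    fix x assume x: "x \<in> topspace X"
    show "x \<in> (\<Union>i<Suc d. P' i \<union> Q' i)"
    proof (cases "x \<in> N")
      case True
      then obtain i where "i < d" "x \<in> G i \<union> H i" by (auto simp: N_def)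
      then have "x \<in> P' i \<union> Q' i" using GHc[of i] by (auto simp: P'_def Q'_def)
      then show ?thesis using \<open>i < d\<close> less_SucI by blast
    next
      case False
      then have "x \<in> P' d \<union> Q' d"
        using x closure_of_subset[OF openin_subset[OF U(1)]] unfolding P'd Q'd by blast
      then show ?thesis by blast
    qed
  qed
  have "separated_pairs X (Suc d) P' Q'"
    unfolding separated_pairs_def using pairs by simp
  then show "\<exists>P Q. separated_pairs X (Suc d) P Q \<and> (\<forall>i<Suc d. A i \<subseteq> P i \<and> B i \<subseteq> Q i) \<and>
      topspace X \<subseteq> (\<Union>i<Suc d. P i \<union> Q i)"
    using pairs cover by (intro exI[of _ P'] exI[of _ Q']) simp
qed

text \<open>Induction along the recursion for dimension. For \<open>d = 0\<close> the bound is -1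
  and the space is empty, so no pairs are needed to cover it. Frontiers are closed, hence again
  compact Hausdorff.\<close>

lemma dim_le_imp_partitionable:
  assumes "X dim_le (int d - 1)" "compact_space X" "Hausdorff_space X"
  shows "partitionable X (topspace X) d"
  using assms
proof (induction d arbitrary: X)
  case 0
  then show ?case by (simp add: partitionable_empty)
next
  case (Suc d)
  show ?case
  proof (rule partitionable_Suc)
    show "normal_space X"
      using Suc.prems compact_Hausdorff_or_regular_imp_normal_space by blast
    fix V a assume "openin X V" "a \<in> V"
    moreover have "X dim_le int d"
      using Suc.prems(1) by simp
    ultimately obtain U where U: "a \<in> U" "U \<subseteq> V" "openin X U"
      "subtopology X (X frontier_of U) dim_le (int d - 1)"
      by (meson dimension_le.cases)
    let ?Y = "X frontier_of U"
    have "closedin X ?Y" by (rule closedin_frontier_of)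
    have "compact_space (subtopology X ?Y)"
      by (rule compact_space_subtopology, rule closedin_compact_space) fact+
    moreover have "Hausdorff_space (subtopology X ?Y)"
      by (rule Hausdorff_space_subtopology) fact
    moreover have "topspace (subtopology X ?Y) = ?Y"
      by (rule topspace_subtopology_subset, rule closedin_subset) fact
    ultimately have "partitionable (subtopology X ?Y) ?Y d"
      using Suc.IH[OF U(4)] by simp
    then have "partitionable X ?Y d"
      by (rule partitionable_subtopology[OF \<open>closedin X ?Y\<close>])
    then show "\<exists>U. a \<in> U \<and> U \<subseteq> V \<and> openin X U \<and> partitionable X (X frontier_of U) d"
      using U by blast
  qed (use Suc.prems in auto)
qed

section \<open>An upper bound for dimension by counting coordinates\<close>

text \<open>
  Box neighbourhoods whose faces avoid \<open>D\<close> have frontiers on which one more coordinate lies in a finite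
  set, so the induction enlarges \<open>D\<close> by the face coordinates.
\<close>

lemma dim_le_few_coordinates_outside_finite:
  fixes Z :: "('a \<Rightarrow> real) set"
  assumes "finite D" "\<And>x. x \<in> Z \<Longrightarrow> finite {i. x i \<notin> D} \<and> card {i. x i \<notin> D} < j"
  shows "top_of_set Z dim_le (int j - 1)"
  using assms
proof (induction j arbitrary: D Z)
  case 0
  then have "Z = {}" by auto
  then show ?case by simp
next
  case (Suc j)
  show ?case
  proof (rule dimension_le.intros)
    fix V a assume V: "openin (top_of_set Z) V" "a \<in> V"
    then obtain W where W: "open W" "V = Z \<inter> W" by (auto simp: openin_open)
    have a: "a \<in> Z" "a \<in> W" using V W by auto
    obtain X where X: "a \<in> Pi\<^sub>E UNIV X" "\<And>i. open (X i)" "finite {i. X i \<noteq> UNIV}" "Pi\<^sub>E UNIV X \<subseteq> W"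
      using product_topology_open_contains_basis[of "\<lambda>i. euclidean" UNIV W a] W(1) a(2)
      by (auto simp: open_fun_def)
    define I where "I = {i. X i \<noteq> UNIV}"
    \<comment> \<open>Every interval next to \<open>a i\<close> is infinite while \<open>D\<close>
      is finite, so the faces of the box can be placed at values outside \<open>D\<close>.\<close>
    have "\<exists>l u. l < a i \<and> a i < u \<and> l \<notin> D \<and> u \<notin> D \<and> {l<..<u} \<subseteq> X i" for i
    proof -
      have "a i \<in> X i" using X(1) by auto
      then obtain e where e: "e > 0" "ball (a i) e \<subseteq> X i"
        using X(2) open_contains_ball by blast
      have "infinite {a i - e<..<a i}" "infinite {a i<..<a i + e}"
        using e(1) by (auto intro: infinite_Ioo)
      then have "{a i - e<..<a i} - D \<noteq> {}" "{a i<..<a i + e} - D \<noteq> {}"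
        using Diff_infinite_finite[OF Suc.prems(1)] by (metis finite.emptyI)+
      then obtain l u where "l \<in> {a i - e<..<a i} - D" "u \<in> {a i<..<a i + e} - D"
        by blast
      moreover from this have "{l<..<u} \<subseteq> ball (a i) e"
        by (auto simp: ball_eq_greaterThanLessThan)
      ultimately show ?thesis using e(2) by (intro exI[of _ l] exI[of _ u]) auto
    qed
    then obtain l u where lu: "\<And>i. l i < a i" "\<And>i. a i < u i" "\<And>i. l i \<notin> D" "\<And>i. u i \<notin> D"
      "\<And>i. {l i<..<u i} \<subseteq> X i" by metis
    have "finite I" using X(3) by (simp add: I_def)
    define O' where "O' = {x :: 'a \<Rightarrow> real. \<forall>i\<in>I. x i \<in> {l i<..<u i}}"
    define C where "C = {x :: 'a \<Rightarrow> real. \<forall>i\<in>I. x i \<in> {l i..u i}}"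
    have "open O'"
      unfolding O'_def using product_topology_basis'[OF \<open>finite I\<close>, of "\<lambda>i. {l i<..<u i}" "\<lambda>i. i"] by simp
    have "closed C"
      unfolding C_def atLeastAtMost_iff Ball_def
      by (intro closed_Collect_all closed_Collect_imp closed_Collect_conj closed_Collect_le
          continuous_on_const continuous_on_product_coordinates open_Collect_const)
    have "O' \<subseteq> C" by (force simp: O'_def C_def)
    have "O' \<subseteq> W"
    proof
      fix x assume "x \<in> O'"
      then have "x i \<in> {l i<..<u i} \<or> X i = UNIV" for i
        unfolding O'_def I_def by blast
      then have "x i \<in> X i" for i
        using lu(5)[of i] by blast
      then show "x \<in> W" using X(4) by (auto simp: PiE_iff)
    qed
    define U where "U = Z \<inter> O'"
    have oU: "openin (top_of_set Z) U"
      unfolding U_def using \<open>open O'\<close> by (rule openin_open_Int)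
    define F where "F = top_of_set Z frontier_of U"
    \<comment> \<open>The frontier lies in the closed box but not in the open one, so each of its
      points has a coordinate equal to some \<open>l i\<close> or \<open>u i\<close>. That value is
      not in \<open>D\<close> but is in \<open>D'\<close>, so the count of exceptional coordinates
      drops.\<close>
    have "top_of_set Z closure_of U \<subseteq> Z \<inter> C"
      using \<open>closed C\<close> \<open>O' \<subseteq> C\<close> by (intro closure_of_minimal) (auto simp: U_def closedin_closed_Int)
    then have F: "F \<subseteq> Z \<inter> C - O'"
      using oU by (auto simp: F_def frontier_of_def interior_of_openin U_def)
    define D' where "D' = D \<union> l ` I \<union> u ` I"
    have "top_of_set F dim_le (int j - 1)"
    proof (rule Suc.IH)
      show "finite D'" using \<open>finite D\<close> \<open>finite I\<close> by (simp add: D'_def)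
      fix x assume "x \<in> F"
      then have x: "x \<in> Z" "x \<in> C" "x \<notin> O'" using F by auto
      then obtain i where "i \<in> I" "x i \<in> {l i..u i}" "x i \<notin> {l i<..<u i}"
        unfolding C_def O'_def by blast
      then have "x i = l i \<or> x i = u i" "i \<in> I" by auto
      then have "x i \<in> D'" "x i \<notin> D" using lu(3,4)[of i] by (auto simp: D'_def)
      then have "{i. x i \<notin> D'} \<subset> {i. x i \<notin> D}" by (auto simp: D'_def)
      moreover note Suc.prems(2)[OF x(1)]
      ultimately show "finite {i. x i \<notin> D'} \<and> card {i. x i \<notin> D'} < j"
        using psubset_card_mono[of "{i. x i \<notin> D}" "{i. x i \<notin> D'}"] finite_subset[of "{i. x i \<notin> D'}" "{i. x i \<notin> D}"]
        by fastforce
    qed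
    moreover have "subtopology (top_of_set Z) F = top_of_set F"
      using F by (simp add: subtopology_subtopology Int_absorb1 le_infI1 subset_iff)
    moreover have "a \<in> U"
      using a lu by (auto simp: U_def O'_def)
    moreover have "U \<subseteq> V"
      using \<open>O' \<subseteq> W\<close> W(2) by (auto simp: U_def)
    ultimately show "\<exists>U. a \<in> U \<and> U \<subseteq> V \<and> openin (top_of_set Z) U \<and>
        subtopology (top_of_set Z) (top_of_set Z frontier_of U) dim_le (int (Suc j) - 1 - 1)"
      using oU unfolding F_def by (intro exI[of _ U]) simp
  qed simp
qed

section \<open>Metric estimates in products and between compact sets\<close>

text \<open>The product metric weights the coordinate distances by powers of 1/2, whose sum is
  2.\<close>

lemma dist_fun_le:
  fixes x y :: "'a::countable \<Rightarrow> 'b::metric_space"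
  assumes "\<And>i. dist (x i) (y i) \<le> e"
  shows "dist x y \<le> 2 * e"
proof -
  have "dist x y \<le> (\<Sum>n. e * (1 / 2) ^ n)"
    unfolding dist_fun_def
  proof (rule suminf_le)
    show "(1 / 2) ^ n * min (dist (x (from_nat n)) (y (from_nat n))) 1 \<le> e * (1 / 2) ^ n" for n
      using assms[of "from_nat n"] by (simp add: mult.commute mult_left_mono min.coboundedI1)
    show "summable (\<lambda>n. (1 / 2) ^ n * min (dist (x (from_nat n)) (y (from_nat n))) 1)"
      by (rule summable_comparison_test'[of "\<lambda>n. (1/2)^n"]) (auto simp: summable_geometric_iff)
  qed (simp add: summable_mult summable_geometric)
  also have "\<dots> = 2 * e"
    by (simp add: suminf_mult suminf_geometric summable_geometric)
  finally show ?thesis .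
qed

lemma compact_disjoint_separated:
  fixes S T :: "'a::metric_space set"
  assumes "compact S" "compact T" "S \<inter> T = {}"
  shows "\<exists>e>0. \<forall>x\<in>S. \<forall>y\<in>T. e \<le> dist x y"
proof (cases "S = {} \<or> T = {}")
  case True
  then show ?thesis by (auto intro: exI[of _ 1])
next
  case False
  have "continuous_on S (\<lambda>x. infdist x T)"
    by (intro continuous_on_infdist continuous_on_id)
  then obtain a where a: "a \<in> S" "\<And>x. x \<in> S \<Longrightarrow> infdist a T \<le> infdist x T"
    using continuous_attains_inf[OF assms(1)] False by metis
  have "infdist a T > 0"
    using infdist_pos_not_in_closed[OF compact_imp_closed[OF assms(2)]] a(1) assms(3) False by blast
  moreover have "infdist a T \<le> dist x y" if "x \<in> S" "y \<in> T" for x y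
    using a(2)[OF that(1)] infdist_le[OF that(2), of x] by linarith
  ultimately show ?thesis by blast
qed

section \<open>The tapered cube and its infinite dimension\<close>

definition tapered_cube :: "(nat \<Rightarrow> real) set" where
  "tapered_cube = {x. x 0 \<le> 1 \<and> (\<forall>i. 0 \<le> x i \<and> x i \<le> x 0 \<and> (x i = 0 \<or> real i * x 0 \<le> 1))}"

lemma compact_tapered_cube: "compact tapered_cube"
proof -
  have "compactin (product_topology (\<lambda>i. euclidean) UNIV) (Pi\<^sub>E UNIV (\<lambda>i::nat. {0..1::real}))"
    by (subst compactin_PiE) auto
  then have "compact (Pi\<^sub>E UNIV (\<lambda>i::nat. {0..1::real}))"
    by (simp add: euclidean_product_topology)
  \<comment> \<open>The tapering is written as a disjunction of two closed conditions, which makes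
    the set closed in the Hilbert cube.\<close>
  moreover have "closed tapered_cube"
    unfolding tapered_cube_def
    by (intro closed_Collect_all closed_Collect_disj closed_Collect_conj closed_Collect_le closed_Collect_eq
          continuous_on_const continuous_on_product_coordinates continuous_on_mult)
  moreover have "tapered_cube \<subseteq> Pi\<^sub>E UNIV (\<lambda>i::nat. {0..1::real})"
    by (simp add: tapered_cube_def subset_iff PiE_iff) (meson order_trans)
  ultimately show ?thesis
    by (metis compact_Int_closed inf.absorb_iff2)
qed

text \<open>For \<open>m > 0\<close>, coordinates 1 to \<open>m\<close> range freely over
  \<open>[0, 1/m]\<close> and all later ones vanish. For \<open>m = 0\<close> division by zero gives
  \<open>x 0 = 0\<close>, so that only the origin remains.\<close>

definition tapered_slice :: "nat \<Rightarrow> (nat \<Rightarrow> real) set" where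
  "tapered_slice m = {x \<in> tapered_cube. x 0 = 1 / real m}"

lemma compact_tapered_slice: "compact (tapered_slice m)"
proof -
  have "closed {x :: nat \<Rightarrow> real. x 0 = 1 / real m}"
    by (intro closed_Collect_eq continuous_on_const continuous_on_product_coordinates)
  then show ?thesis
    using compact_Int_closed[OF compact_tapered_cube]
    by (simp add: tapered_slice_def Collect_conj_eq)
qed

text \<open>Enlarged opposite faces covering the cube would label a fine grid by closeness to
  \<open>P i\<close>. Kuhn's lemma yields a small cell carrying both labels for every
  \<open>i\<close>, but a vertex of the cell lies in some \<open>P i\<close> or \<open>Q i\<close>,
  which forces a single label for that \<open>i\<close>.\<close>

lemma not_partitionable_tapered_slice:
  assumes "m > 0"
  shows "\<not> partitionable (top_of_set (tapered_slice m)) (tapered_slice m) m"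
proof
  define C where "C = tapered_slice m"
  assume "partitionable (top_of_set (tapered_slice m)) (tapered_slice m) m"
  then have part: "partitionable (top_of_set C) C m" by (simp add: C_def)
  \<comment> \<open>Pair \<open>i\<close> uses coordinate \<open>Suc i\<close>, since coordinate 0
    is constant on the slice.\<close>
  define A where "A i = C \<inter> {x. x (Suc i) = 0}" for i
  define B where "B i = C \<inter> {x. x (Suc i) = 1 / real m}" for i
  have "separated_pairs (top_of_set C) m A B"
    using assms unfolding A_def B_def separated_pairs_def
    by (auto intro!: closedin_closed_Int closed_Collect_eq
        continuous_on_const continuous_on_product_coordinates)
  then obtain P Q where PQ: "separated_pairs (top_of_set C) m P Q"
    "\<forall>i<m. A i \<subseteq> P i \<and> B i \<subseteq> Q i" "C \<subseteq> (\<Union>i<m. P i \<union> Q i)"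
    by (rule partitionableD[OF part])
  have cP: "compact (P i)" and cQ: "compact (Q i)" if "i < m" for i
    using separated_pairsD(1,2)[OF PQ(1) that] closedin_compact compact_tapered_slice unfolding C_def by blast+
  have "\<forall>i<m. \<exists>e>0. \<forall>x\<in>P i. \<forall>y\<in>Q i. e \<le> dist x y"
    using compact_disjoint_separated[OF cP cQ] separated_pairsD(3)[OF PQ(1)] by blast
  then obtain e where e: "\<And>i. i < m \<Longrightarrow> e i > 0"
    "\<And>i x y. i < m \<Longrightarrow> x \<in> P i \<Longrightarrow> y \<in> Q i \<Longrightarrow> e i \<le> dist x y"
    by metis
  define \<delta> where "\<delta> = Min (e ` {..<m})"
  have \<delta>: "\<delta> > 0" "\<And>i x y. i < m \<Longrightarrow> x \<in> P i \<Longrightarrow> y \<in> Q i \<Longrightarrow> \<delta> \<le> dist x y"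
  proof -
    show "\<delta> > 0" unfolding \<delta>_def by (subst Min_gr_iff) (use e(1) assms in auto)
    have "\<delta> \<le> e i" if "i < m" for i using that by (simp add: \<delta>_def)
    then show "\<And>i x y. i < m \<Longrightarrow> x \<in> P i \<Longrightarrow> y \<in> Q i \<Longrightarrow> \<delta> \<le> dist x y"
      using e(2) order_trans by blast
  qed
  \<comment> \<open>Neighbouring grid points differ by at most \<open>1/p\<close> in each
    coordinate, hence by at most \<open>2/p\<close> in the product metric, which is then below
    \<open>\<delta> / 2\<close>.\<close>
  obtain p :: nat where p: "p > 0" "1 / real p < \<delta> / 4"
    using real_arch_inverse[of "\<delta> / 4"] \<delta>(1) by (auto simp: inverse_eq_divide)
  \<comment> \<open>\<open>g\<close> places the grid with indices from 0 to \<open>p\<close> in the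
    slice; the scale sends \<open>q i = p\<close> to the face \<open>1 / real m\<close>.\<close>
  define g where "g q i = (if i = 0 then 1 / real m else if i \<le> m then real (q (i - 1)) / (real m * real p) else 0)"
    for q :: "nat \<Rightarrow> nat" and i :: nat
  have gC: "g q \<in> C" if "\<And>i. i < m \<Longrightarrow> q i \<le> p" for q
  proof -
    have "real (q (i - 1)) / (real m * real p) \<le> 1 / real m" if "i \<noteq> 0" "i \<le> m" for i
    proof -
      have "q (i - 1) \<le> p" using that \<open>\<And>i. i < m \<Longrightarrow> q i \<le> p\<close> by simp
      then show ?thesis using assms p(1) by (simp add: field_simps)
    qed
    then show ?thesis
      using assms by (auto simp: C_def tapered_slice_def tapered_cube_def g_def field_simps)
  qed
  \<comment> \<open>Points near neither set get label 1. Points within \<open>\<delta> / 2\<close>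
    of \<open>Q i\<close> cannot be that close to \<open>P i\<close>, so they also get label
    1.\<close>
  define label where "label q i = (if \<exists>y\<in>P i. dist (g q) y < \<delta> / 2 then 0 else 1 :: nat)" for q i
  have gA: "g q \<in> P i" if "\<And>i. i < m \<Longrightarrow> q i \<le> p" "i < m" "q i = 0" for q i
    using gC[OF that(1)] that(2,3) PQ(2)[rule_format, OF that(2)] by (auto simp: A_def g_def)
  have gB: "g q \<in> Q i" if "\<And>i. i < m \<Longrightarrow> q i \<le> p" "i < m" "q i = p" for q i
    using gC[OF that(1)] that(2,3) PQ(2)[rule_format, OF that(2)] p(1) by (auto simp: B_def g_def)
  have label_P: "label r i = 0" if "i < m" "x \<in> P i" "dist (g r) x < \<delta> / 2" for r i x
    using that by (auto simp: label_def)
  have label_Q: "label r i = 1" if "i < m" "x \<in> Q i" "dist (g r) x < \<delta> / 2" for r i x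
  proof (rule ccontr)
    assume "label r i \<noteq> 1"
    then obtain y where "y \<in> P i" "dist (g r) y < \<delta> / 2" by (auto simp: label_def split: if_splits)
    with that \<delta>(2)[of i y x] dist_triangle3[of y x "g r"] show False by linarith
  qed
  have "\<forall>x. (\<forall>i<m. x i \<le> p) \<longrightarrow> (\<forall>i<m. label x i = 0 \<or> label x i = 1)"
    by (auto simp: label_def)
  moreover have "\<forall>x. (\<forall>i<m. x i \<le> p) \<longrightarrow> (\<forall>i<m. x i = 0 \<longrightarrow> label x i = 0)"
    using gA label_P \<delta>(1) by (metis dist_self half_gt_zero)
  moreover have "\<forall>x. (\<forall>i<m. x i \<le> p) \<longrightarrow> (\<forall>i<m. x i = p \<longrightarrow> label x i = 1)"
    using gB label_Q \<delta>(1) by (metis dist_self half_gt_zero)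
  ultimately obtain q where q: "\<forall>i<m. q i < p"
    "\<forall>i<m. \<exists>r s. (\<forall>j<m. q j \<le> r j \<and> r j \<le> q j + 1) \<and> (\<forall>j<m. q j \<le> s j \<and> s j \<le> q j + 1) \<and> label r i \<noteq> label s i"
    by (rule kuhn_lemma[OF p(1)])
  have near: "dist (g r) (g q) < \<delta> / 2" if "\<forall>j<m. q j \<le> r j \<and> r j \<le> q j + 1" for r
  proof -
    have "dist (g r i) (g q i) \<le> 1 / real p" for i
    proof (cases "i \<noteq> 0 \<and> i \<le> m")
      case True
      then have "q (i - 1) \<le> r (i - 1)" "r (i - 1) \<le> q (i - 1) + 1" using that by auto
      then have "\<bar>real (r (i - 1)) - real (q (i - 1))\<bar> \<le> 1" by linarith
      then have "\<bar>real (r (i - 1)) - real (q (i - 1))\<bar> / (real m * real p) \<le> 1 / (real m * real p)"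
        by (rule divide_right_mono) simp
      also have "\<dots> \<le> 1 / real p"
        using assms p(1) by (simp add: field_simps)
      finally show ?thesis
        using True by (simp add: g_def dist_real_def flip: diff_divide_distrib)
    qed (auto simp: g_def)
    then have "dist (g r) (g q) \<le> 2 * (1 / real p)" by (rule dist_fun_le)
    then show ?thesis using p(2) by linarith
  qed
  \<comment> \<open>All vertices of the cell are within \<open>\<delta> / 2\<close> of
    \<open>g q\<close>. The set \<open>P i\<close> or \<open>Q i\<close> containing
    \<open>g q\<close> therefore fixes their \<open>i\<close>-th label, against the two different
    labels at \<open>r\<close> and \<open>s\<close>.\<close>
  have "g q \<in> C" using gC[of q] q(1) less_imp_le by blast
  then obtain i where i: "i < m" "g q \<in> P i \<union> Q i" using PQ(3) by blast
  obtain r s where "\<forall>j<m. q j \<le> r j \<and> r j \<le> q j + 1" "\<forall>j<m. q j \<le> s j \<and> s j \<le> q j + 1"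
    and ne: "label r i \<noteq> label s i"
    using q(2) i(1) by blast
  with near have "dist (g r) (g q) < \<delta> / 2" "dist (g s) (g q) < \<delta> / 2" by blast+
  with i ne label_P label_Q show False by (metis UnE)
qed

lemma not_dim_le_tapered_cube: "\<not> top_of_set tapered_cube dim_le d"
proof
  assume dim: "top_of_set tapered_cube dim_le d"
  \<comment> \<open>This choice gives both \<open>d \<le> int m - 1\<close> and
    \<open>m > 0\<close>, also for negative \<open>d\<close>.\<close>
  define m where "m = Suc (nat (d + 1))"
  let ?C = "tapered_slice m"
  have "top_of_set tapered_cube dim_le (int m - 1)"
    using dim by (rule dimension_le_mono) (simp add: m_def)
  then have "top_of_set ?C dim_le (int m - 1)"
    by (rule dimension_le_subtopologies) (auto simp: tapered_slice_def)
  then have "partitionable (top_of_set ?C) (topspace (top_of_set ?C)) m"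
    using compact_tapered_slice
    by (intro dim_le_imp_partitionable) (auto simp: compact_space_subtopology Hausdorff_space_subtopology)
  then show False
    using not_partitionable_tapered_slice[of m] by (simp add: m_def)
qed

section \<open>Finite dimension away from the origin, and the fibres\<close>

lemma dim_T_compact_subset_tapered_cube:
  assumes "compact S" "S \<subseteq> tapered_cube" "(\<lambda>_. 0) \<notin> S"
  shows "dim_T (top_of_set S) < \<infinity>"
proof -
  \<comment> \<open>Coordinate 0 attains its minimum on a nonempty \<open>S\<close>. The minimum is
    positive because \<open>x 0 = 0\<close> squeezes every coordinate to 0; for empty
    \<open>S\<close> any positive constant works.\<close>
  obtain c where c: "c > 0" "\<And>x. x \<in> S \<Longrightarrow> c \<le> x 0"
  proof (cases "S = {}")
    case False
    have "continuous_on S (\<lambda>x. x 0)"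
      by (rule continuous_on_subset[OF continuous_on_product_coordinates]) simp
    then obtain x where x: "x \<in> S" "\<And>y. y \<in> S \<Longrightarrow> x 0 \<le> y 0"
      using continuous_attains_inf[OF assms(1) False] by blast
    have "x 0 \<noteq> 0"
    proof
      assume "x 0 = 0"
      then have "x = (\<lambda>_. 0)"
        using x(1) assms(2) by (auto simp: tapered_cube_def fun_eq_iff intro!: antisym)
      with x(1) assms(3) show False by simp
    qed
    then have "x 0 > 0" using x(1) assms(2) by (force simp: tapered_cube_def)
    with x that show thesis by blast
  qed (use that[of 1] in auto)
  obtain N :: nat where N: "1 / c < real N" using reals_Archimedean2 by blast
  have "{i. x i \<notin> {0}} \<subseteq> {..N}" if "x \<in> S" for x
  proof
    fix i assume "i \<in> {i. x i \<notin> {0}}"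
    then have "real i * x 0 \<le> 1" using that assms(2) by (auto simp: tapered_cube_def)
    moreover have "real i * c \<le> real i * x 0" using c(2)[OF that] by (intro mult_left_mono) auto
    ultimately have "real i \<le> 1 / c" using c(1) by (simp add: field_simps)
    then show "i \<in> {..N}" using N by simp
  qed
  \<comment> \<open>The set \<open>{..N}\<close> has \<open>N + 1\<close> elements, and the strict
    bound on the count requires \<open>N + 2\<close>.\<close>
  then have "finite {i. x i \<notin> {0}} \<and> card {i. x i \<notin> {0}} < N + 2" if "x \<in> S" for x
    using that card_mono[of "{..N}" "{i. x i \<notin> {0}}"] finite_subset[of _ "{..N}"] by fastforce
  then have "top_of_set S dim_le (int (N + 2) - 1)"
    by (intro dim_le_few_coordinates_outside_finite[of "{0}"]) auto
  then have "dim_T (top_of_set S) \<le> ereal (real_of_int (int (N + 2) - 1))"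
    by (simp only: dim_T_le_iff)
  then show ?thesis
    using le_less_trans less_ereal.simps(4) by blast
qed

theorem fact7p7:
  shows "\<exists>(K :: (nat \<Rightarrow> real) set) (d :: (nat \<Rightarrow> real) \<Rightarrow> (nat \<Rightarrow> real) \<Rightarrow> real).
    Metric_space K d \<and> compact_space (Metric_space.mtopology K d) \<and>
    dim_T (Metric_space.mtopology K d) = \<infinity> \<and>
    (\<forall>f :: (nat \<Rightarrow> real) \<Rightarrow> real ^ 'n.
      continuous_map (Metric_space.mtopology K d) euclidean f \<longrightarrow>
      (\<exists>y\<^sub>f. \<forall>y \<in> UNIV - {y\<^sub>f}.
        dim_T (subtopology (Metric_space.mtopology K d) (f -` {y} \<inter> K)) < \<infinity>))"
proof -
  let ?K = tapered_cube
  interpret Submetric UNIV dist ?K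
    by unfold_locales auto
  have mt: "Metric_space.mtopology ?K dist = top_of_set ?K"
    using mtopology_submetric by simp
  show ?thesis
  proof (intro exI[of _ ?K] exI[of _ dist] conjI allI impI, unfold mt)
    show "Metric_space ?K dist" ..
    show "compact_space (top_of_set ?K)"
      using compact_tapered_cube by (simp add: compact_space_subtopology)
    \<comment> \<open>With no integer bound available, the infimum is over the empty set and equals
      infinity.\<close>
    have "{ereal (real_of_int d) |d. top_of_set ?K dim_le d} = {}"
      using not_dim_le_tapered_cube by blast
    then show "dim_T (top_of_set ?K) = \<infinity>"
      unfolding dim_T_def by (simp add: top_ereal_def)
    fix f :: "(nat \<Rightarrow> real) \<Rightarrow> real ^ 'n"
    assume "continuous_map (top_of_set ?K) euclidean f"
    then have f: "continuous_on ?K f" by simp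
    show "\<exists>y\<^sub>f. \<forall>y\<in>UNIV - {y\<^sub>f}. dim_T (subtopology (top_of_set ?K) (f -` {y} \<inter> ?K)) < \<infinity>"
    \<comment> \<open>The exceptional value is the image of the origin; every other fibre is a
      compact set that misses the origin.\<close>
    proof (intro exI[of _ "f (\<lambda>_. 0)"] ballI)
      fix y assume y: "y \<in> UNIV - {f (\<lambda>_. 0)}"
      have "closedin (top_of_set ?K) (?K \<inter> f -` {y})"
        using f by (intro continuous_closedin_preimage) auto
      then have "compact (f -` {y} \<inter> ?K)"
        using closedin_compact[OF compact_tapered_cube] by (simp add: Int_commute)
      then have "dim_T (top_of_set (f -` {y} \<inter> ?K)) < \<infinity>"
        using y by (intro dim_T_compact_subset_tapered_cube) auto
      then show "dim_T (subtopology (top_of_set ?K) (f -` {y} \<inter> ?K)) < \<infinity>"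
        by (simp add: subtopology_subtopology Int_absorb1)
    qed
  qed
qed

end
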